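(* Let $\mathcal H$ be the Hecke algebra of $G_4$. The following twelve elements together form an $R$-basis of the centralizer $Z_{\mathcal H}(\tilde T_s)$ of $\tilde T_s$ in $\mathcal H$: (1) $\tilde T_1$; (2) $\tilde T_s$; (3) $\tilde T_{s^2}$; (4) $\tilde T_{ts^2t}$; (5) $\tilde T_{ts^2ts}$; (6) $\tilde T_{tststs}$; (7) $\tilde T_t+\tilde T_{s^2ts}+\tilde T_{sts^2}-\xi_2\tilde T_{sts}$; (8) $\tilde T_{t^2}+\tilde T_{s^2t^2s}+\tilde T_{st^2s^2}-\xi_2\tilde T_{st^2s}$; (9) $\tilde T_{st}+\tilde T_{ts}+\tilde T_{s^2ts^2}+\xi_1\tilde T_{sts}$; (10) $\tilde T_{st^2}+\tilde T_{t^2s}+\tilde T_{s^2t^2s^2}+\xi_1\tilde T_{st^2s}$; (11) $\tilde T_{s^2t}+\tilde T_{ts^2}+\tilde T_{sts}+\xi_1\tilde T_{s^2ts}+\xi_1\tilde T_{sts^2}+\xi_2\tilde T_{s^2ts^2}$; (12) $\tilde T_{s^2t^2}+\tilde T_{t^2s^2}+\tilde T_{st^2s}+\xi_1\tilde T_{s^2t^2s}+\xi_1\tilde T_{st^2s^2}+\xi_2\tilde T_{s^2t^2s^2}$.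
   Context: $G_4=\langle s,t\mid s^3=t^3=1,\ sts=tst\rangle$ (a group of order 24). Let $\xi_1,\xi_2$ be indeterminates and $R=\mathbb Z[\xi_1,\xi_2]$. The Hecke algebra $\mathcal H$ of $G_4$ is the $R$-algebra generated by $\tilde T_s,\tilde T_t$ subject to $\tilde T_s\tilde T_t\tilde T_s=\tilde T_t\tilde T_s\tilde T_t$ and $\tilde T_x^3=1+\xi_1\tilde T_x+\xi_2\tilde T_x^2$ for $x\in\{s,t\}$. For a word $x_1\cdots x_k$ in $s,t$ put $\tilde T_{x_1\cdots x_k}=\tilde T_{x_1}\cdots\tilde T_{x_k}$, $\tilde T_1=1$. $\mathcal H$ is a free $R$-module of rank 24, with $R$-basis $B_{sts}$ consisting of the elements $\tilde T_w$ for the words $w\in\{1,s,t,s^2,t^2,st,ts,st^2,t^2s,s^2t,ts^2,s^2t^2,t^2s^2,st^2s,ts^2t,s^2ts^2,t^2st^2,ststst,sts,sts^2,s^2ts,s^2t^2s,st^2s^2,s^2t^2s^2\}$. (By the braid relation, $\tilde T_{ts^2ts}=\tilde T_{t^2st^2}$ and $\tilde T_{tststs}=\tilde T_{ststst}$.) *)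

theory Defs
  imports "HOL-Computational_Algebra.Polynomial" "HOL-Library.Poly_Mapping"
begin

text \<open>The base ring \<open>R = \<int>[\<xi>\<^sub>1, \<xi>\<^sub>2]\<close>, realised as \<open>(\<int>[\<xi>\<^sub>1])[\<xi>\<^sub>2]\<close>.\<close>

type_synonym base = "int poly poly"

definition \<xi>\<^sub>1 :: base where
  "\<xi>\<^sub>1 = [:[:0, 1:]:]"

definition \<xi>\<^sub>2 :: base where
  "\<xi>\<^sub>2 = [:0, 1:]"

text \<open>
  The free associative algebra \<open>R\<langle>s, t\<rangle>\<close> is the monoid algebra over \<open>R\<close> of the free monoid
  on two letters. As \<^typ>\<open>'a \<Rightarrow>\<^sub>0 'b\<close> takes its multiplication from a (possibly
  non-commutative) additive monoid of exponents, concatenation of words is written \<open>+\<close>.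
\<close>

datatype gen = \<s> | \<t>

datatype word = Word "gen list"

instantiation word :: monoid_add
begin

definition zero_word :: word where
  "0 = Word []"

fun plus_word :: "word \<Rightarrow> word \<Rightarrow> word" where
  "Word u + Word v = Word (u @ v)"

instance
proof
  fix a b c :: word
  show "a + b + c = a + (b + c)"
    by (cases a; cases b; cases c) simp
  show "0 + a = a" "a + 0 = a"
    by (cases a; simp add: zero_word_def)+
qed

end

type_synonym free_alg = "word \<Rightarrow>\<^sub>0 base"

definition free_gen :: "gen \<Rightarrow> free_alg" where
  "free_gen x = Poly_Mapping.single (Word [x]) 1"

definition free_const :: "base \<Rightarrow> free_alg" where
  "free_const c = Poly_Mapping.single 0 c"

definition relators :: "free_alg set" where
  "relators =
     insert (free_gen \<s> * free_gen \<t> * free_gen \<s> - free_gen \<t> * free_gen \<s> * free_gen \<t>)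
       {free_gen x ^ 3 - (1 + free_const \<xi>\<^sub>1 * free_gen x + free_const \<xi>\<^sub>2 * free_gen x ^ 2) |x. True}"

text \<open>The two-sided ideal generated by the relators.\<close>

inductive_set hecke_ideal :: "free_alg set" where
  zero: "0 \<in> hecke_ideal"
| add: "a \<in> hecke_ideal \<Longrightarrow> b \<in> hecke_ideal \<Longrightarrow> a + b \<in> hecke_ideal"
| rel: "r \<in> relators \<Longrightarrow> a * r * b \<in> hecke_ideal"

lemma hecke_ideal_mult_left: "a \<in> hecke_ideal \<Longrightarrow> c * a \<in> hecke_ideal"
proof (induction rule: hecke_ideal.induct)
  case (rel r a b)
  then show ?case
    using hecke_ideal.rel[of r "c * a" b] by (simp add: mult.assoc)
qed (auto simp: distrib_left intro: hecke_ideal.intros)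

lemma hecke_ideal_mult_right: "a \<in> hecke_ideal \<Longrightarrow> a * c \<in> hecke_ideal"
proof (induction rule: hecke_ideal.induct)
  case (rel r a b)
  then show ?case
    using hecke_ideal.rel[of r a "b * c"] by (simp add: mult.assoc)
qed (auto simp: distrib_right intro: hecke_ideal.intros)

lemma hecke_ideal_uminus: "a \<in> hecke_ideal \<Longrightarrow> - a \<in> hecke_ideal"
  using hecke_ideal_mult_left[of a "- 1"] by simp

lemma hecke_ideal_diff: "a \<in> hecke_ideal \<Longrightarrow> b \<in> hecke_ideal \<Longrightarrow> a - b \<in> hecke_ideal"
  using hecke_ideal.add[of a "- b"] hecke_ideal_uminus[of b] by simp

definition hecke_rel :: "free_alg \<Rightarrow> free_alg \<Rightarrow> bool" where
  "hecke_rel a b \<longleftrightarrow> a - b \<in> hecke_ideal"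

lemma equivp_hecke_rel: "equivp hecke_rel"
proof (rule equivpI)
  show "reflp hecke_rel"
    by (auto simp: reflp_def hecke_rel_def hecke_ideal.zero)
  show "symp hecke_rel"
    using hecke_ideal_uminus by (fastforce simp: symp_def hecke_rel_def)
  show "transp hecke_rel"
    using hecke_ideal.add by (fastforce simp: transp_def hecke_rel_def)
qed

lemma free_alg_induct [case_names zero single add]:
  fixes f :: free_alg
  assumes "P 0" "\<And>w c. P (Poly_Mapping.single w c)" "\<And>f g. P f \<Longrightarrow> P g \<Longrightarrow> P (f + g)"
  shows "P f"
proof (induction f rule: update_induct)
  case (update f a b)
  have "Poly_Mapping.update a b f = Poly_Mapping.single a b + f"
    using update.hyps
    by (intro poly_mapping_eqI)
      (auto simp: lookup_update lookup_add lookup_single when_def in_keys_iff)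
  then show ?case
    using assms update.IH by simp
qed (rule assms)

lemma free_const_mult_commute: "free_const c * a = a * free_const c"
  by (induction a rule: free_alg_induct)
    (auto simp: free_const_def distrib_left distrib_right mult_single mult.commute)

text \<open>
  The class \<^class>\<open>ring_1\<close> demands \<open>0 \<noteq> 1\<close> in the quotient. This is witnessed by the ring
  homomorphism to \<open>\<int>\<close> with \<open>\<xi>\<^sub>1, \<xi>\<^sub>2 \<mapsto> 0\<close> and \<open>s, t \<mapsto> 1\<close>, which kills the relators.
\<close>

definition aug :: "free_alg \<Rightarrow> int" where
  "aug f = Sum_any (\<lambda>w. poly (poly (Poly_Mapping.lookup f w) 0) 0)"

lemma aug_zero [simp]: "aug 0 = 0"
  by (simp add: aug_def)

lemma aug_single [simp]: "aug (Poly_Mapping.single w c) = poly (poly c 0) 0"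
proof -
  have "aug (Poly_Mapping.single w c) = Sum_any (\<lambda>v. poly (poly c 0) 0 when v = w)"
    unfolding aug_def by (rule Sum_any.cong) (auto simp: lookup_single when_def)
  then show ?thesis
    by simp
qed

lemma aug_add [simp]: "aug (f + g) = aug f + aug g"
proof -
  have "finite {w. poly (poly (Poly_Mapping.lookup f w) 0) 0 \<noteq> 0}" for f :: free_alg
    by (rule finite_subset[OF _ finite_keys[of f]]) (auto simp: in_keys_iff)
  then show ?thesis
    by (simp add: aug_def lookup_add Sum_any.distrib)
qed

lemma aug_diff [simp]: "aug (f - g) = aug f - aug g"
  using aug_add[of "f - g" g] by simp

lemma aug_mult [simp]: "aug (f * g) = aug f * aug g"
proof (induction f rule: free_alg_induct)
  case (single v c)
  show ?case
    by (induction g rule: free_alg_induct) (simp_all add: mult_single distrib_left)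
qed (simp_all add: distrib_right)

lemma aug_one [simp]: "aug 1 = 1"
  using aug_single[of 0 1] by simp

lemma aug_relators: "r \<in> relators \<Longrightarrow> aug r = 0"
  by (auto simp: relators_def free_gen_def free_const_def \<xi>\<^sub>1_def \<xi>\<^sub>2_def power3_eq_cube
      power2_eq_square)

lemma aug_hecke_ideal: "a \<in> hecke_ideal \<Longrightarrow> aug a = 0"
  by (induction rule: hecke_ideal.induct) (simp_all add: aug_relators)

text \<open>The Hecke algebra \<open>\<H>\<close> of \<open>G\<^sub>4\<close>.\<close>

quotient_type hecke = free_alg / hecke_rel
  by (rule equivp_hecke_rel)

instantiation hecke :: ring_1
begin

lift_definition zero_hecke :: hecke is 0 .

lift_definition one_hecke :: hecke is 1 .

lift_definition plus_hecke :: "hecke \<Rightarrow> hecke \<Rightarrow> hecke" is "(+)"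
  unfolding hecke_rel_def by (metis add_diff_add hecke_ideal.add)

lift_definition uminus_hecke :: "hecke \<Rightarrow> hecke" is uminus
  unfolding hecke_rel_def using hecke_ideal_uminus by fastforce

lift_definition minus_hecke :: "hecke \<Rightarrow> hecke \<Rightarrow> hecke" is "(-)"
  unfolding hecke_rel_def
  by (metis (no_types, lifting) add_diff_add diff_conv_add_uminus hecke_ideal.add
      hecke_ideal_uminus minus_diff_minus)

lift_definition times_hecke :: "hecke \<Rightarrow> hecke \<Rightarrow> hecke" is "(*)"
proof -
  fix a a' b b' :: free_alg
  assume "hecke_rel a a'" "hecke_rel b b'"
  then have "a * (b - b') + (a - a') * b' \<in> hecke_ideal"
    unfolding hecke_rel_def
    by (intro hecke_ideal.add hecke_ideal_mult_left hecke_ideal_mult_right)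
  then show "hecke_rel (a * b) (a' * b')"
    by (simp add: hecke_rel_def algebra_simps)
qed

instance
proof
  fix a b c :: hecke
  have eq: "x = y \<Longrightarrow> hecke_rel x y" for x y
    using equivp_reflp[OF equivp_hecke_rel] by simp
  show "a + b + c = a + (b + c)"
    by transfer (rule eq, simp add: algebra_simps)
  show "a + b = b + a"
    by transfer (rule eq, simp add: algebra_simps)
  show "0 + a = a"
    by transfer (rule eq, simp)
  show "- a + a = 0"
    by transfer (rule eq, simp)
  show "a - b = a + - b"
    by transfer (rule eq, simp)
  show "a * b * c = a * (b * c)"
    by transfer (rule eq, simp add: mult.assoc)
  show "(a + b) * c = a * c + b * c"
    by transfer (rule eq, simp add: distrib_right)
  show "a * (b + c) = a * b + a * c"
    by transfer (rule eq, simp add: distrib_left)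
  show "1 * a = a"
    by transfer (rule eq, simp)
  show "a * 1 = a"
    by transfer (rule eq, simp)
  show "(0::hecke) \<noteq> 1"
  proof transfer
    show "\<not> hecke_rel 0 1"
      using aug_hecke_ideal[of "0 - 1"] unfolding hecke_rel_def aug_diff by auto
  qed
qed

end

lift_definition hecke_gen :: "gen \<Rightarrow> hecke" is free_gen .

lift_definition hecke_const :: "base \<Rightarrow> hecke" is free_const .

lemma hecke_const_add: "hecke_const (c + d) = hecke_const c + hecke_const d"
  by transfer (simp add: free_const_def single_add hecke_rel_def hecke_ideal.zero)

lemma hecke_const_mult: "hecke_const (c * d) = hecke_const c * hecke_const d"
  by transfer (simp add: free_const_def mult_single hecke_rel_def hecke_ideal.zero)

lemma hecke_const_1: "hecke_const 1 = 1"
  by transfer (simp add: free_const_def hecke_rel_def hecke_ideal.zero)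

lemma hecke_const_commute: "hecke_const c * h = h * hecke_const c"
  by transfer (simp add: free_const_mult_commute hecke_rel_def hecke_ideal.zero)

text \<open>The \<open>R\<close>-module structure of \<open>\<H>\<close>.\<close>

definition hecke_scale :: "base \<Rightarrow> hecke \<Rightarrow> hecke"  (infixr "*\<^sub>H" 75) where
  "c *\<^sub>H h = hecke_const c * h"

interpretation hecke: module hecke_scale
  by unfold_locales
    (simp_all add: hecke_scale_def hecke_const_add hecke_const_mult hecke_const_1 algebra_simps)

lemma hecke_scale_mult_left: "(c *\<^sub>H g) * h = c *\<^sub>H (g * h)"
  by (simp add: hecke_scale_def mult.assoc)

lemma hecke_scale_mult_right: "g * (c *\<^sub>H h) = c *\<^sub>H (g * h)"
  by (metis hecke_scale_def hecke_const_commute mult.assoc)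

text \<open>\<open>\<T> [x\<^sub>1, \<dots>, x\<^sub>k]\<close> is the element written \<open>T\<^sub>w\<close> with a tilde for the word \<open>w = x\<^sub>1 \<dots> x\<^sub>k\<close>.\<close>

definition \<T> :: "gen list \<Rightarrow> hecke" where
  "\<T> w = prod_list (map hecke_gen w)"

lemma \<T>_Nil: "\<T> [] = 1"
  by (simp add: \<T>_def)

lemma \<T>_append: "\<T> (u @ v) = \<T> u * \<T> v"
  by (simp add: \<T>_def)

lemma hecke_eqI: "a - b \<in> relators \<Longrightarrow> hecke_rel a b"
  using hecke_ideal.rel[of "a - b" 1 1] by (simp add: hecke_rel_def)

lemma hecke_braid: "\<T> [\<s>, \<t>, \<s>] = \<T> [\<t>, \<s>, \<t>]"
proof -
  have "hecke_gen \<s> * hecke_gen \<t> * hecke_gen \<s> = hecke_gen \<t> * hecke_gen \<s> * hecke_gen \<t>"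
    by transfer (rule hecke_eqI, simp add: relators_def)
  then show ?thesis
    by (simp add: \<T>_def mult.assoc)
qed

lemma hecke_cubic: "\<T> [x] ^ 3 = 1 + \<xi>\<^sub>1 *\<^sub>H \<T> [x] + \<xi>\<^sub>2 *\<^sub>H \<T> [x] ^ 2"
proof -
  have "hecke_gen x * hecke_gen x * hecke_gen x =
      1 + hecke_const \<xi>\<^sub>1 * hecke_gen x + hecke_const \<xi>\<^sub>2 * (hecke_gen x * hecke_gen x)"
    by transfer
      (rule hecke_eqI, auto simp: relators_def power3_eq_cube power2_eq_square)
  then show ?thesis
    by (simp add: \<T>_def hecke_scale_def power3_eq_cube power2_eq_square mult.assoc)
qed

definition centralizer :: "hecke \<Rightarrow> hecke set" where
  "centralizer x = {h. h * x = x * h}"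

text \<open>
  A family, listed as \<open>bs\<close>, is an \<open>R\<close>-basis of \<open>M \<subseteq> \<H>\<close>. Distinctness is needed because
  \<open>hecke.independent\<close> is a property of sets and does not see repetitions.
\<close>

definition hecke_basis :: "hecke list \<Rightarrow> hecke set \<Rightarrow> bool" where
  "hecke_basis bs M \<longleftrightarrow>
     distinct bs \<and> hecke.independent (set bs) \<and> hecke.span (set bs) = M"

end

theory Submission
  imports Defs
begin

text \<open>
  Put \<open>A = R[s]\<close> and \<open>u = t s\<^sup>2 t\<close>, which commutes with \<open>s\<close>. As an \<open>A\<close>-bimodule the Hecke algebra is
  \<open>A \<oplus> A t A \<oplus> A t\<^sup>2 A \<oplus> A u\<close>, where the two middle summands are copies of \<open>A \<otimes>\<^sub>R A\<close> and the outer ones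
  of \<open>A\<close>. Hence the centralizer of \<open>s\<close> contains \<open>A\<close> and \<open>A u\<close>, and in each copy of \<open>A \<otimes>\<^sub>R A\<close> one
  solves \<open>s m = m s\<close>, which leaves the coefficients of \<open>s\<^sup>a \<otimes> 1\<close> free and determines all others.

  The bimodule decomposition comes from the left regular representation on \<open>R\<^sup>2\<^sup>4\<close>: the relations are
  checked on explicit operators, so that the coordinates of an element of the algebra are
  well-defined, and the 24 words are shown to span a left ideal containing \<open>1\<close>.
\<close>

section \<open>Coordinates and the operators of left and right multiplication\<close>

text \<open>
  The indices \<open>C1 a\<close>, \<open>Ct a b\<close>, \<open>Ctt a b\<close>, \<open>Cu a\<close> stand for \<open>s\<^sup>a\<close>, \<open>s\<^sup>a t s\<^sup>b\<close>, \<open>s\<^sup>a t\<^sup>2 s\<^sup>b\<close>, \<open>s\<^sup>a u = u s\<^sup>a\<close>.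
\<close>

datatype expo = E0 | E1 | E2

datatype cell = C1 expo | Ct expo expo | Ctt expo expo | Cu expo

type_synonym coord = "cell \<Rightarrow> base"

text \<open>Multiplication by \<open>s\<close> and by its inverse \<open>s\<^sup>2 - \<xi>\<^sub>2 s - \<xi>\<^sub>1\<close>, in the basis \<open>1, s, s\<^sup>2\<close> of \<open>A\<close>.\<close>

fun shift :: "(expo \<Rightarrow> base) \<Rightarrow> expo \<Rightarrow> base" where
  "shift g E0 = g E2"
| "shift g E1 = g E0 + \<xi>\<^sub>1 * g E2"
| "shift g E2 = g E1 + \<xi>\<^sub>2 * g E2"

fun unshift :: "(expo \<Rightarrow> base) \<Rightarrow> expo \<Rightarrow> base" where
  "unshift g E0 = g E1 - \<xi>\<^sub>1 * g E0"
| "unshift g E1 = g E2 - \<xi>\<^sub>2 * g E0"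
| "unshift g E2 = g E0"

fun s_act :: "coord \<Rightarrow> coord" where
  "s_act f (C1 a) = shift (\<lambda>i. f (C1 i)) a"
| "s_act f (Ct a b) = shift (\<lambda>i. f (Ct i b)) a"
| "s_act f (Ctt a b) = shift (\<lambda>i. f (Ctt i b)) a"
| "s_act f (Cu a) = shift (\<lambda>i. f (Cu i)) a"

text \<open>
  The coefficients come from \<open>t s t = s t s\<close>, the cubic relation and the two identities
  \<open>t u = s t\<^sup>2 s\<^sup>-\<^sup>1 + \<xi>\<^sub>1 s\<^sup>2 t + \<xi>\<^sub>2 u\<close> and \<open>u t = s\<^sup>-\<^sup>1 t\<^sup>2 s + \<xi>\<^sub>1 t s\<^sup>2 + \<xi>\<^sub>2 u\<close>.
\<close>

fun t_act :: "coord \<Rightarrow> coord" where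
  "t_act f (C1 b) = f (Ctt E0 b)"
| "t_act f (Ct E0 b) =
    f (C1 b) + \<xi>\<^sub>1 * f (Ctt E0 b) + \<xi>\<^sub>1 * shift (shift (\<lambda>j. f (Ctt E2 j))) b"
| "t_act f (Ct E1 b) = shift (\<lambda>j. f (Ct E1 j)) b"
| "t_act f (Ct E2 b) = shift (\<lambda>j. f (Ctt E1 j)) b + \<xi>\<^sub>1 * f (Cu b)"
| "t_act f (Ctt E0 b) = f (Ct E0 b) + \<xi>\<^sub>2 * f (Ctt E0 b) - \<xi>\<^sub>1 * shift (\<lambda>j. f (Ctt E2 j)) b"
| "t_act f (Ctt E1 b) = unshift (\<lambda>j. f (Cu j)) b - \<xi>\<^sub>2 * shift (\<lambda>j. f (Ctt E2 j)) b"
| "t_act f (Ctt E2 b) = shift (\<lambda>j. f (Ctt E2 j)) b"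
| "t_act f (Cu b) = f (Ct E2 b) + \<xi>\<^sub>2 * f (Ctt E2 b) + \<xi>\<^sub>2 * f (Cu b)"

text \<open>Right multiplication by s. The clauses for \<open>C1\<close> and \<open>Cu\<close>
  repeat those of \<open>s_act\<close>, since s commutes with its own powers and with u.\<close>

fun s_ract :: "coord \<Rightarrow> coord" where
  "s_ract f (C1 a) = shift (\<lambda>i. f (C1 i)) a"
| "s_ract f (Ct a b) = shift (\<lambda>j. f (Ct a j)) b"
| "s_ract f (Ctt a b) = shift (\<lambda>j. f (Ctt a j)) b"
| "s_ract f (Cu a) = shift (\<lambda>i. f (Cu i)) a"

fun gen_act :: "gen \<Rightarrow> coord \<Rightarrow> coord" where
  "gen_act \<s> = s_act"
| "gen_act \<t> = t_act"

lemma expo_all: "(\<forall>a. P a) \<longleftrightarrow> P E0 \<and> P E1 \<and> P E2"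
  by (metis expo.exhaust)

lemma cell_all:
  "(\<forall>c. P c) \<longleftrightarrow> (\<forall>a. P (C1 a)) \<and> (\<forall>a b. P (Ct a b)) \<and> (\<forall>a b. P (Ctt a b)) \<and> (\<forall>a. P (Cu a))"
  by (metis cell.exhaust)

lemma UNIV_expo: "UNIV = {E0, E1, E2}"
  using expo.exhaust by auto

instance expo :: finite
  by standard (simp add: UNIV_expo)

instance cell :: finite
proof
  have "UNIV = range C1 \<union> range (case_prod Ct) \<union> range (case_prod Ctt) \<union> range Cu"
    by (auto simp: image_iff) (metis cell.exhaust)
  then show "finite (UNIV :: cell set)"
    by (metis finite_UnI finite_imageI finite)
qed

text \<open>Comparing the 24 coordinates leaves polynomial identities. With
  \<open>gen_act_cubic\<close> this makes the operators a representation of the Hecke algebra before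
  anything is known about its bases.\<close>

lemma gen_act_braid: "s_act (t_act (s_act f)) = t_act (s_act (t_act f))"
  by (simp add: fun_eq_iff cell_all expo_all algebra_simps)

lemma gen_act_cubic:
  "gen_act x (gen_act x (gen_act x f)) =
    (\<lambda>c. f c + \<xi>\<^sub>1 * gen_act x f c + \<xi>\<^sub>2 * gen_act x (gen_act x f) c)"
  by (cases x) (simp_all add: fun_eq_iff cell_all expo_all algebra_simps)

text \<open>The operator form of associativity, x (h s) = (x h) s. It later identifies
  \<open>s_ract\<close> with right multiplication by s.\<close>

lemma gen_act_s_ract: "gen_act x (s_ract f) = s_ract (gen_act x f)"
  by (cases x) (simp_all add: fun_eq_iff cell_all expo_all algebra_simps)

lemma gen_act_add: "gen_act x (\<lambda>c. f c + g c) = (\<lambda>c. gen_act x f c + gen_act x g c)"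
  by (cases x) (simp_all add: fun_eq_iff cell_all expo_all algebra_simps)

lemma gen_act_scale: "gen_act x (\<lambda>c. k * f c) = (\<lambda>c. k * gen_act x f c)"
  by (cases x) (simp_all add: fun_eq_iff cell_all expo_all algebra_simps)

lemma s_ract_add: "s_ract (\<lambda>c. f c + g c) = (\<lambda>c. s_ract f c + s_ract g c)"
  by (simp add: fun_eq_iff cell_all expo_all algebra_simps)

lemma s_ract_scale: "s_ract (\<lambda>c. k * f c) = (\<lambda>c. k * s_ract f c)"
  by (simp add: fun_eq_iff cell_all expo_all algebra_simps)

section \<open>The representation of the free algebra and its descent to the quotient\<close>

fun word_act :: "word \<Rightarrow> coord \<Rightarrow> coord" where
  "word_act (Word xs) v = foldr gen_act xs v"

lemma word_act_zero [simp]: "word_act 0 v = v"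
  by (simp add: zero_word_def)

lemma word_act_plus: "word_act (u + w) v = word_act u (word_act w v)"
  by (cases u; cases w) simp

lemma word_act_add: "word_act w (\<lambda>c. f c + g c) = (\<lambda>c. word_act w f c + word_act w g c)"
proof (cases w)
  case (Word xs)
  show ?thesis
    unfolding Word by (induction xs) (simp_all add: gen_act_add)
qed

lemma word_act_scale: "word_act w (\<lambda>c. k * f c) = (\<lambda>c. k * word_act w f c)"
proof (cases w)
  case (Word xs)
  show ?thesis
    unfolding Word by (induction xs) (simp_all add: gen_act_scale)
qed

definition free_act :: "free_alg \<Rightarrow> coord \<Rightarrow> coord" where
  "free_act f v c = Sum_any (\<lambda>w. Poly_Mapping.lookup f w * word_act w v c)"

lemma free_act_zero [simp]: "free_act 0 v = (\<lambda>c. 0)"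
  by (simp add: fun_eq_iff free_act_def)

lemma free_act_single [simp]: "free_act (Poly_Mapping.single w k) v = (\<lambda>c. k * word_act w v c)"
proof
  fix c
  have "free_act (Poly_Mapping.single w k) v c = Sum_any (\<lambda>u. k * word_act w v c when u = w)"
    unfolding free_act_def by (rule Sum_any.cong) (auto simp: lookup_single when_def)
  then show "free_act (Poly_Mapping.single w k) v c = k * word_act w v c"
    by simp
qed

lemma free_act_add [simp]: "free_act (f + g) v = (\<lambda>c. free_act f v c + free_act g v c)"
proof
  fix c
  have "finite {w. Poly_Mapping.lookup f w * word_act w v c \<noteq> 0}" for f :: free_alg
    by (rule finite_subset[OF _ finite_keys[of f]]) (auto simp: in_keys_iff)
  then show "free_act (f + g) v c = free_act f v c + free_act g v c"
    by (simp add: free_act_def lookup_add distrib_right Sum_any.distrib)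
qed

lemma free_act_diff [simp]: "free_act (f - g) v = (\<lambda>c. free_act f v c - free_act g v c)"
  using free_act_add[of "f - g" g v] by (simp add: fun_eq_iff)

lemma free_act_one [simp]: "free_act 1 v = v"
  using free_act_single[of 0 1 v] by simp

lemma free_act_scale_right: "free_act f (\<lambda>c. k * v c) = (\<lambda>c. k * free_act f v c)"
  by (induction f rule: free_alg_induct) (simp_all add: word_act_scale algebra_simps)

lemma free_act_mult [simp]: "free_act (f * g) v = free_act f (free_act g v)"
proof (induction f rule: free_alg_induct)
  case (single w k)
  show ?case
    by (induction g rule: free_alg_induct)
      (simp_all add: mult_single word_act_plus word_act_add word_act_scale
        word_act_scale[where k = 0, simplified] distrib_left mult.assoc)
qed (simp_all add: distrib_right)

lemma free_act_gen: "free_act (free_gen x) v = gen_act x v"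
  by (simp add: free_gen_def)

lemma free_act_const: "free_act (free_const k) v = (\<lambda>c. k * v c)"
  by (simp add: free_const_def)

lemma free_act_relators: "r \<in> relators \<Longrightarrow> free_act r v = (\<lambda>c. 0)"
  using gen_act_cubic[of _ v] gen_act_braid[of v]
  by (auto simp: relators_def free_act_gen free_act_const power3_eq_cube power2_eq_square)

text \<open>In a product \<open>a * r * b\<close> the relator \<open>r\<close> sends every vector to
  0, and the scaling rule at \<open>k = 0\<close> shows that \<open>a\<close> fixes the zero
  vector.\<close>

lemma free_act_hecke_ideal: "a \<in> hecke_ideal \<Longrightarrow> free_act a v = (\<lambda>c. 0)"
  by (induction rule: hecke_ideal.induct)
    (simp_all add: free_act_relators free_act_scale_right[where k = 0, simplified])

lift_definition act :: "hecke \<Rightarrow> coord \<Rightarrow> coord" is free_act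
  unfolding hecke_rel_def by (metis (no_types, lifting) ext eq_iff_diff_eq_0 free_act_diff
      free_act_hecke_ideal)

lemma act_add [simp]: "act (g + h) v c = act g v c + act h v c"
  by transfer simp

lemma act_mult: "act (g * h) v = act g (act h v)"
  by transfer simp

lemma act_one [simp]: "act 1 v = v"
  by transfer simp

lemma act_zero [simp]: "act 0 v c = 0"
  by transfer simp

lemma act_diff [simp]: "act (g - h) v c = act g v c - act h v c"
  using act_add[of "g - h" h v c] by simp

lemma act_scale [simp]: "act (k *\<^sub>H h) v c = k * act h v c"
  unfolding hecke_scale_def by transfer (simp add: free_act_const)

lemma act_gen: "act (hecke_gen x) v = gen_act x v"
  by transfer (simp add: free_act_gen)

lemma abs_hecke_single: "abs_hecke (Poly_Mapping.single (Word w) 1) = \<T> w"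
proof (induction w)
  case Nil
  show ?case
    by (simp add: \<T>_def one_hecke.abs_eq flip: zero_word_def)
next
  case (Cons x w)
  have "Poly_Mapping.single (Word (x # w)) 1 = free_gen x * Poly_Mapping.single (Word w) 1"
    by (simp add: free_gen_def mult_single)
  then show ?case
    using Cons by (simp add: \<T>_def hecke_gen.abs_eq flip: times_hecke.abs_eq)
qed

lemma hecke_induct [case_names word scale add]:
  assumes "\<And>w. P (\<T> w)" "\<And>c g. P g \<Longrightarrow> P (c *\<^sub>H g)" "\<And>f g. P f \<Longrightarrow> P g \<Longrightarrow> P (f + g)"
  shows "P h"
proof (induction h rule: hecke.abs_induct)
  case (1 f)
  show ?case
  proof (induction f rule: free_alg_induct)
    case zero
    show ?case
      \<comment> \<open>Zero is reached as the multiple by 0 of the empty word.\<close>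
      using assms(2)[of "\<T> []" 0, OF assms(1)] by (simp flip: zero_hecke_def)
  next
    case (single w c)
    obtain xs where w: "w = Word xs"
      by (cases w)
    have "Poly_Mapping.single w c = free_const c * Poly_Mapping.single w 1"
      by (simp add: free_const_def mult_single)
    then have "abs_hecke (Poly_Mapping.single w c) = c *\<^sub>H \<T> xs"
      by (simp add: w abs_hecke_single hecke_scale_def hecke_const.abs_eq flip: times_hecke.abs_eq)
    then show ?case
      using assms(1,2) by simp
  next
    case (add f g)
    then show ?case
      using assms(3) by (simp flip: plus_hecke.abs_eq)
  qed
qed

lemma \<T>_Cons: "\<T> (x # w) = hecke_gen x * \<T> w"
  by (simp add: \<T>_def)

lemma act_s_ract: "act h (s_ract v) = s_ract (act h v)"
proof (induction h arbitrary: v rule: hecke_induct)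
  case (word w)
  show ?case
    by (induction w) (simp_all add: \<T>_Nil \<T>_Cons act_mult act_gen gen_act_s_ract)
next
  case (scale c g)
  have "act (c *\<^sub>H g) (s_ract v) = (\<lambda>d. c * s_ract (act g v) d)"
    by (simp add: fun_eq_iff scale)
  also have "\<dots> = s_ract (\<lambda>d. c * act g v d)"
    by (simp add: s_ract_scale)
  also have "(\<lambda>d. c * act g v d) = act (c *\<^sub>H g) v"
    by (simp add: fun_eq_iff)
  finally show ?case .
next
  case (add f g)
  have "act (f + g) (s_ract v) = (\<lambda>d. s_ract (act f v) d + s_ract (act g v) d)"
    by (simp add: fun_eq_iff add)
  also have "\<dots> = s_ract (\<lambda>d. act f v d + act g v d)"
    by (simp add: s_ract_add)
  also have "(\<lambda>d. act f v d + act g v d) = act (f + g) v"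
    by (simp add: fun_eq_iff)
  finally show ?case .
qed

section \<open>Coordinates of the elements of the algebra\<close>

definition unit_coord :: "cell \<Rightarrow> coord" where
  "unit_coord c d = (if c = d then 1 else 0)"

text \<open>Images of basis vectors that are again basis vectors. They evaluate a word letter by
  letter from the right, for the 24 words and also for tststs = u s^2.\<close>

lemma gen_act_unit_coord [simp]:
  "s_act (unit_coord (C1 E0)) = unit_coord (C1 E1)"
  "s_act (unit_coord (C1 E1)) = unit_coord (C1 E2)"
  "s_act (unit_coord (Ct E0 b)) = unit_coord (Ct E1 b)"
  "s_act (unit_coord (Ct E1 b)) = unit_coord (Ct E2 b)"
  "s_act (unit_coord (Ctt E0 b)) = unit_coord (Ctt E1 b)"
  "s_act (unit_coord (Ctt E1 b)) = unit_coord (Ctt E2 b)"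
  "t_act (unit_coord (C1 b)) = unit_coord (Ct E0 b)"
  "t_act (unit_coord (Ct E0 b)) = unit_coord (Ctt E0 b)"
  "t_act (unit_coord (Ct E1 E0)) = unit_coord (Ct E1 E1)"
  "t_act (unit_coord (Ct E1 E1)) = unit_coord (Ct E1 E2)"
  "t_act (unit_coord (Ct E2 b)) = unit_coord (Cu b)"
  by (cases b; simp add: fun_eq_iff cell_all expo_all unit_coord_def)+

definition coords :: "hecke \<Rightarrow> coord" where
  "coords h = act h (unit_coord (C1 E0))"

lemma coords_simps [simp]:
  "coords 0 c = 0"
  "coords (g + h) c = coords g c + coords h c"
  "coords (g - h) c = coords g c - coords h c"
  "coords (k *\<^sub>H h) c = k * coords h c"
  by (simp_all add: coords_def)

lemma coords_\<T> [simp]: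
  "coords (\<T> []) = unit_coord (C1 E0)"
  "coords (\<T> (x # w)) = gen_act x (coords (\<T> w))"
  by (simp_all add: coords_def \<T>_Nil \<T>_Cons act_mult act_gen)

lemma coords_mult_s_left: "coords (\<T> [\<s>] * h) = s_act (coords h)"
  by (simp add: coords_def act_mult \<T>_def act_gen)

text \<open>The vector of s is obtained from that of 1 by right as well as by left multiplication.
  In the right form, \<open>s_ract\<close> moves out past the action of \<open>h\<close>.\<close>

lemma coords_mult_s_right: "coords (h * \<T> [\<s>]) = s_ract (coords h)"
proof -
  have "s_act (unit_coord (C1 E0)) = s_ract (unit_coord (C1 E0))"
    by (simp only: fun_eq_iff cell_all expo_all) (simp add: unit_coord_def)
  then show ?thesis
    by (simp add: coords_def act_mult \<T>_def act_gen act_s_ract del: gen_act_unit_coord)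
qed

fun s_word :: "expo \<Rightarrow> gen list" where
  "s_word E0 = []"
| "s_word E1 = [\<s>]"
| "s_word E2 = [\<s>, \<s>]"

fun cell_word :: "cell \<Rightarrow> gen list" where
  "cell_word (C1 a) = s_word a"
| "cell_word (Ct a b) = s_word a @ \<t> # s_word b"
| "cell_word (Ctt a b) = s_word a @ \<t> # \<t> # s_word b"
| "cell_word (Cu a) = [\<t>, \<s>, \<s>, \<t>] @ s_word a"

text \<open>The independence half: the coordinate functionals are dual to the 24 words. The spanning
  half is \<open>cell_span_UNIV\<close>.\<close>

lemma coords_cell_word: "coords (\<T> (cell_word c)) = unit_coord c"
proof -
  have "\<forall>c. coords (\<T> (cell_word c)) = unit_coord c"
    by (simp add: cell_all expo_all)
  then show ?thesis ..
qed

section \<open>The 24 words span the algebra\<close>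

abbreviation cell_span :: "hecke set" where
  "cell_span \<equiv> hecke.span (range (\<lambda>c. \<T> (cell_word c)))"

lemma cell_span_word: "\<T> (cell_word c) \<in> cell_span"
  by (rule hecke.span_base) simp

abbreviation S :: hecke where "S \<equiv> hecke_gen \<s>"
abbreviation T :: hecke where "T \<equiv> hecke_gen \<t>"

lemma braid: "S * (T * S) = T * (S * T)" "S * (T * (S * x)) = T * (S * (T * x))"
  using hecke_braid by (simp_all add: \<T>_def mult.assoc) (simp flip: mult.assoc)

lemma cubic:
  "hecke_gen x * (hecke_gen x * hecke_gen x) =
    1 + \<xi>\<^sub>1 *\<^sub>H hecke_gen x + \<xi>\<^sub>2 *\<^sub>H (hecke_gen x * hecke_gen x)"
  using hecke_cubic[of x] by (simp add: \<T>_def power3_eq_cube power2_eq_square mult.assoc)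

lemma cubic_mult:
  "hecke_gen x * (hecke_gen x * (hecke_gen x * h)) =
    h + \<xi>\<^sub>1 *\<^sub>H (hecke_gen x * h) + \<xi>\<^sub>2 *\<^sub>H (hecke_gen x * (hecke_gen x * h))"
  using arg_cong[OF cubic[of x], of "\<lambda>y. y * h"]
  by (simp add: mult.assoc distrib_right hecke_scale_mult_left)

text \<open>This is s u = u s, by (sts)st = (tst)st = ts(tst) = ts(sts).\<close>

lemma S_u: "S * (T * (S * (S * T))) = T * (S * (S * (T * S)))"
  by (metis braid mult.assoc)

lemma S_u': "S * (T * (S * (S * (T * h)))) = T * (S * (S * (T * (S * h))))"
  by (metis S_u mult.assoc)

lemma in_cell_span:
  "1 \<in> cell_span" "T \<in> cell_span" "T * T \<in> cell_span"
  "T * (S * (S * T)) \<in> cell_span"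
  using cell_span_word[of "C1 E0"] cell_span_word[of "Ct E0 E0"] cell_span_word[of "Ctt E0 E0"] cell_span_word[of "Cu E0"]
  by (simp_all add: \<T>_def)

lemma cell_span_mult_closed:
  assumes "\<And>c. g * \<T> (cell_word c) \<in> cell_span" "h \<in> cell_span"
  shows "g * h \<in> cell_span"
  using assms(2)
proof (induction rule: hecke.span_induct_alt)
  case base
  then show ?case
    by (simp add: hecke.span_zero)
next
  case (step c x y)
  then show ?case
    using assms(1) by (auto simp: distrib_left hecke_scale_mult_right intro!: hecke.span_add hecke.span_scale)
qed

lemma cell_span_mult_closed':
  assumes "\<And>c. \<T> (cell_word c) * g \<in> cell_span" "h \<in> cell_span"
  shows "h * g \<in> cell_span"
  using assms(2)
proof (induction rule: hecke.span_induct_alt)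
  case base
  then show ?case
    by (simp add: hecke.span_zero)
next
  case (step c x y)
  then show ?case
    using assms(1) by (auto simp: distrib_right hecke_scale_mult_left intro!: hecke.span_add hecke.span_scale)
qed

text \<open>Only for \<open>E2\<close> does the extra letter give a new power, s^3, which the cubic
  relation reduces. The free contexts \<open>u\<close> and \<open>w\<close> serve multiplication by
  s from both sides.\<close>

lemma cell_span_cubic:
  assumes "\<And>a. \<T> (u @ s_word a @ w) \<in> cell_span"
  shows "\<T> (u @ \<s> # s_word a @ w) \<in> cell_span"
proof (cases a)
  case E0
  then show ?thesis
    using assms[of E1] by simp
next
  case E1
  then show ?thesis
    using assms[of E2] by simp
next
  case E2
  have "\<T> (u @ \<s> # s_word a @ w) = \<T> (u @ s_word E0 @ w) + \<xi>\<^sub>1 *\<^sub>H \<T> (u @ s_word E1 @ w)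
      + \<xi>\<^sub>2 *\<^sub>H \<T> (u @ s_word E2 @ w)"
    by (simp add: E2 \<T>_append \<T>_Cons cubic_mult distrib_left hecke_scale_mult_right)
  then show ?thesis
    using assms by (metis hecke.span_add hecke.span_scale)
qed

lemma s_word_snoc: "s_word a @ [\<s>] = \<s> # s_word a"
  by (cases a) simp_all

lemma \<T>_s_u: "\<T> (\<s> # \<t> # \<s> # \<s> # \<t> # w) = \<T> (\<t> # \<s> # \<s> # \<t> # \<s> # w)"
  by (simp add: \<T>_Cons S_u')

lemma cell_span_S_left: "h \<in> cell_span \<Longrightarrow> S * h \<in> cell_span"
proof (rule cell_span_mult_closed)
  fix c
  have "\<T> (\<s> # cell_word c) \<in> cell_span"
  proof (cases c)
    case (C1 a)
    then show ?thesis
      using cell_span_cubic[of "[]" "[]"] cell_span_word[of "C1 _"] by simp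
  next
    case (Ct a b)
    then show ?thesis
      using cell_span_cubic[of "[]" "\<t> # s_word b"] cell_span_word[of "Ct _ b"] by simp
  next
    case (Ctt a b)
    then show ?thesis
      using cell_span_cubic[of "[]" "\<t> # \<t> # s_word b"] cell_span_word[of "Ctt _ b"] by simp
  next
    case (Cu a)
    then show ?thesis
      using cell_span_cubic[of "[\<t>, \<s>, \<s>, \<t>]" "[]"] cell_span_word[of "Cu _"]
      by (simp add: \<T>_s_u)
  qed
  then show "S * \<T> (cell_word c) \<in> cell_span"
    by (simp add: \<T>_Cons)
qed

lemma cell_span_S_right: "h \<in> cell_span \<Longrightarrow> h * S \<in> cell_span"
proof (rule cell_span_mult_closed')
  fix c
  have "\<T> (cell_word c @ [\<s>]) \<in> cell_span"
  proof (cases c)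
    case (C1 a)
    then show ?thesis
      using cell_span_cubic[of "[]" "[]"] cell_span_word[of "C1 _"] by (simp add: s_word_snoc)
  next
    case (Ct a b)
    then show ?thesis
      using cell_span_cubic[of "s_word a @ [\<t>]" "[]"] cell_span_word[of "Ct a _"]
      by (simp add: s_word_snoc)
  next
    case (Ctt a b)
    then show ?thesis
      using cell_span_cubic[of "s_word a @ [\<t>, \<t>]" "[]"] cell_span_word[of "Ctt a _"]
      by (simp add: s_word_snoc)
  next
    case (Cu a)
    then show ?thesis
      using cell_span_cubic[of "[\<t>, \<s>, \<s>, \<t>]" "[]"] cell_span_word[of "Cu _"]
      by (simp add: s_word_snoc)
  qed
  then show "\<T> (cell_word c) * S \<in> cell_span"
    by (simp add: \<T>_append) (simp add: \<T>_def)
qed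

text \<open>The constant term 1 of the cubic relation makes the generators invertible. Trading x^2
  for x^-1 and lower terms brings squares within reach of the braid relation.\<close>

definition gen_inv :: "gen \<Rightarrow> hecke" where
  "gen_inv x = hecke_gen x * hecke_gen x - \<xi>\<^sub>1 *\<^sub>H 1 - \<xi>\<^sub>2 *\<^sub>H hecke_gen x"

lemma gen_inv: "hecke_gen x * gen_inv x = 1" "gen_inv x * hecke_gen x = 1"
  using cubic[of x]
  by (simp_all add: gen_inv_def right_diff_distrib left_diff_distrib mult.assoc
      hecke_scale_mult_left hecke_scale_mult_right)

lemma gen_square: "hecke_gen x * hecke_gen x = gen_inv x + \<xi>\<^sub>1 *\<^sub>H 1 + \<xi>\<^sub>2 *\<^sub>H hecke_gen x"
  by (simp add: gen_inv_def)

lemma cell_span_gen_inv: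
  assumes "h \<in> cell_span"
  shows "gen_inv \<s> * h \<in> cell_span" "h * gen_inv \<s> \<in> cell_span"
proof -
  have "gen_inv \<s> * h = S * (S * h) - \<xi>\<^sub>1 *\<^sub>H h - \<xi>\<^sub>2 *\<^sub>H (S * h)"
    by (simp add: gen_inv_def left_diff_distrib mult.assoc hecke_scale_mult_left)
  then show "gen_inv \<s> * h \<in> cell_span"
    using assms by (simp add: hecke.span_diff hecke.span_scale cell_span_S_left)
  have "h * gen_inv \<s> = (h * S) * S - \<xi>\<^sub>1 *\<^sub>H h - \<xi>\<^sub>2 *\<^sub>H (h * S)"
    by (simp add: gen_inv_def right_diff_distrib mult.assoc hecke_scale_mult_right)
  then show "h * gen_inv \<s> \<in> cell_span"
    using assms by (simp only: hecke.span_diff hecke.span_scale cell_span_S_right)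
qed

lemma gen_inv_T_in: "gen_inv \<t> \<in> cell_span"
  unfolding gen_inv_def
  by (intro hecke.span_diff hecke.span_scale in_cell_span)

text \<open>Each identity is sts = tst multiplied by inverses. The right-hand sides contain a single
  t or t^-1 between powers of s, so they lie in the span.\<close>

lemma braid_inv:
  "gen_inv \<t> * (gen_inv \<s> * T) = S * (gen_inv \<t> * gen_inv \<s>)"
  "T * (gen_inv \<s> * gen_inv \<t>) = gen_inv \<s> * (gen_inv \<t> * S)"
  "T * (S * gen_inv \<t>) = gen_inv \<s> * (T * S)"
proof -
  have cancel: "gen_inv x * (hecke_gen x * h) = h" "hecke_gen x * (gen_inv x * h) = h" for x h
    by (simp_all add: gen_inv flip: mult.assoc)
  \<comment> \<open>The inserted factors cancel; they create tst, to which the braid relation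
    applies.\<close>
  have "T = T * (S * (T * (gen_inv \<t> * gen_inv \<s>)))"
    by (simp add: cancel gen_inv)
  also have "\<dots> = S * (T * (S * (gen_inv \<t> * gen_inv \<s>)))"
    by (simp add: braid)
  finally have "gen_inv \<t> * (gen_inv \<s> * T)
      = gen_inv \<t> * (gen_inv \<s> * (S * (T * (S * (gen_inv \<t> * gen_inv \<s>)))))"
    by (rule arg_cong)
  then show "gen_inv \<t> * (gen_inv \<s> * T) = S * (gen_inv \<t> * gen_inv \<s>)"
    by (simp add: cancel)
  have "T * (gen_inv \<s> * gen_inv \<t>)
      = gen_inv \<s> * (gen_inv \<t> * (T * (S * (T * (gen_inv \<s> * gen_inv \<t>)))))"
    by (simp add: cancel)
  also have "\<dots> = gen_inv \<s> * (gen_inv \<t> * (S * (T * (S * (gen_inv \<s> * gen_inv \<t>)))))"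
    by (simp add: braid)
  finally show "T * (gen_inv \<s> * gen_inv \<t>) = gen_inv \<s> * (gen_inv \<t> * S)"
    by (simp add: cancel gen_inv)
  have "T * (S * gen_inv \<t>) = gen_inv \<s> * (S * (T * (S * gen_inv \<t>)))"
    by (simp add: cancel)
  then show "T * (S * gen_inv \<t>) = gen_inv \<s> * (T * S)"
    by (simp add: braid gen_inv)
qed

lemma T_S_inv_T_in: "T * (gen_inv \<s> * T) \<in> cell_span"
proof -
  have "T * (gen_inv \<s> * T) = T * (S * (S * T)) - \<xi>\<^sub>1 *\<^sub>H (T * T) - \<xi>\<^sub>2 *\<^sub>H (S * T * S)"
    by (simp add: gen_inv_def left_diff_distrib right_diff_distrib hecke_scale_mult_left
        hecke_scale_mult_right mult.assoc braid)
  then show ?thesis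
    by (simp add: hecke.span_diff hecke.span_scale in_cell_span cell_span_S_left cell_span_S_right)
qed

text \<open>In t^2 s^2 t first s^2 and then t^2 is traded for an inverse. The leading term t^-1 s^-1
  t collapses by \<open>braid_inv\<close>; the others reduce by the cubic relation, by
  \<open>T_S_inv_T_in\<close> and by t(tst) = t(sts) = (sts)s.\<close>

lemma T_u_in: "T * (T * (S * (S * T))) \<in> cell_span"
proof -
  have TT: "T * (T * h) = gen_inv \<t> * h + \<xi>\<^sub>1 *\<^sub>H h + \<xi>\<^sub>2 *\<^sub>H (T * h)" for h
    using arg_cong[OF gen_square[of \<t>], of "\<lambda>y. y * h"]
    by (simp add: mult.assoc distrib_right hecke_scale_mult_left)
  have SS: "S * (S * h) = gen_inv \<s> * h + \<xi>\<^sub>1 *\<^sub>H h + \<xi>\<^sub>2 *\<^sub>H (S * h)" for h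
    using arg_cong[OF gen_square[of \<s>], of "\<lambda>y. y * h"]
    by (simp add: mult.assoc distrib_right hecke_scale_mult_left)
  have "T * (T * (S * (S * T))) =
      T * (T * (gen_inv \<s> * T)) + \<xi>\<^sub>1 *\<^sub>H (T * (T * T)) + \<xi>\<^sub>2 *\<^sub>H (T * (T * (S * T)))"
    by (simp add: SS distrib_left hecke_scale_mult_right)
  also have "T * (T * (gen_inv \<s> * T)) = S * (gen_inv \<t> * gen_inv \<s>)
      + \<xi>\<^sub>1 *\<^sub>H (gen_inv \<s> * T) + \<xi>\<^sub>2 *\<^sub>H (T * (gen_inv \<s> * T))"
    by (simp add: TT braid_inv)
  also have "T * (T * (S * T)) = S * T * S * S"
    by (simp add: mult.assoc braid flip: braid(1))
  finally show ?thesis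
    using in_cell_span
    by (simp only: cubic) (intro hecke.span_add hecke.span_scale cell_span_S_left cell_span_S_right
      cell_span_gen_inv gen_inv_T_in T_S_inv_T_in)
qed

text \<open>Here t^2 is traded before s^2, so that both t s^-1 t^-1 and t s t^-1 occur;
  \<open>braid_inv\<close> collapses them.\<close>

lemma u_T_in: "T * (S * (S * (T * T))) \<in> cell_span"
proof -
  have "T * (S * (S * (T * T))) =
      T * (S * (S * gen_inv \<t>)) + \<xi>\<^sub>1 *\<^sub>H (T * S * S) + \<xi>\<^sub>2 *\<^sub>H (T * (S * (S * T)))"
    by (simp add: gen_square[of \<t>] distrib_left hecke_scale_mult_right mult.assoc)
  also have "T * (S * (S * gen_inv \<t>)) =
      T * (gen_inv \<s> * gen_inv \<t>) + \<xi>\<^sub>1 *\<^sub>H (T * gen_inv \<t>) + \<xi>\<^sub>2 *\<^sub>H (T * (S * gen_inv \<t>))"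
    using arg_cong[OF gen_square[of \<s>], of "\<lambda>y. T * (y * gen_inv \<t>)"]
    by (simp add: mult.assoc distrib_right distrib_left hecke_scale_mult_left hecke_scale_mult_right)
  finally show ?thesis
    using in_cell_span
    by (simp only: braid_inv gen_inv)
      (intro hecke.span_add hecke.span_scale cell_span_S_left cell_span_S_right
      cell_span_gen_inv gen_inv_T_in)
qed

lemma cell_span_s_word: "h \<in> cell_span \<Longrightarrow> h * \<T> (s_word a) \<in> cell_span"
  using cell_span_S_right[of h] cell_span_S_right[of "h * S"]
  by (cases a) (simp_all add: \<T>_def mult.assoc)

lemma cell_span_T_left: "h \<in> cell_span \<Longrightarrow> T * h \<in> cell_span"
proof (rule cell_span_mult_closed)
  fix c
  \<comment> \<open>A trailing power of s may be split off, which leaves t times 1, s^a t, s^a t^2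
    or u.\<close>
  have right: "T * \<T> (cell_word c) \<in> cell_span"
    if "T * \<T> (cell_word c) = h * \<T> (s_word b)" "h \<in> cell_span" for h b
    using that cell_span_s_word by simp
  show "T * \<T> (cell_word c) \<in> cell_span"
  proof (cases c)
    case (C1 a)
    show ?thesis
      by (rule right[of T a]) (simp_all add: C1 in_cell_span)
  next
    case (Ct a b)
    show ?thesis
    proof (cases a)
      case E0
      show ?thesis
        by (rule right[of "T * T" b]) (simp_all add: Ct E0 in_cell_span \<T>_Cons mult.assoc)
    next
      case E1
      have "S * (T * S) \<in> cell_span"
        by (intro cell_span_S_left cell_span_S_right in_cell_span)
      then show ?thesis
        by (intro right[of "S * (T * S)" b]) (simp_all add: Ct E1 \<T>_Cons mult.assoc braid)
    next
      case E2
      show ?thesis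
        by (rule right[of "T * (S * (S * T))" b]) (simp_all add: Ct E2 in_cell_span \<T>_Cons mult.assoc)
    qed
  next
    case (Ctt a b)
    show ?thesis
    proof (cases a)
      case E0
      have "T * (T * T) \<in> cell_span"
        unfolding cubic by (intro hecke.span_add hecke.span_scale in_cell_span)
      then show ?thesis
        by (intro right[of "T * (T * T)" b]) (simp_all add: Ctt E0 \<T>_Cons mult.assoc)
    next
      case E1
      \<comment> \<open>Two braid moves: (tst)t = s(tst) = s(sts).\<close>
      have "T * (S * (T * (T * h))) = S * (S * (T * (S * h)))" for h
        by (metis braid(2))
      moreover have "S * (S * (T * S)) \<in> cell_span"
        by (intro cell_span_S_left cell_span_S_right in_cell_span)
      ultimately show ?thesis
        by (intro right[of "S * (S * (T * S))" b]) (simp_all add: Ctt E1 \<T>_Cons mult.assoc)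
    next
      case E2
      show ?thesis
        by (rule right[of "T * (S * (S * (T * T)))" b])
          (simp_all add: Ctt E2 u_T_in \<T>_Cons mult.assoc)
    qed
  next
    case (Cu a)
    show ?thesis
      by (rule right[of "T * (T * (S * (S * T)))" a])
        (simp_all add: Cu T_u_in \<T>_Cons mult.assoc)
  qed
qed

lemma cell_span_UNIV: "cell_span = UNIV"
proof -
  have "h \<in> cell_span" for h
  proof (induction h rule: hecke_induct)
    case (word w)
    show ?case
    proof (induction w)
      case Nil
      show ?case
        using in_cell_span by (simp add: \<T>_Nil)
    next
      case (Cons x w)
      then show ?case
        by (cases x) (simp_all add: \<T>_Cons cell_span_S_left cell_span_T_left)
    qed
  qed (auto intro: hecke.span_add hecke.span_scale)
  then show ?thesis
    by auto
qed

lemma hecke_eq_sum_coords: "h = (\<Sum>c\<in>UNIV. coords h c *\<^sub>H \<T> (cell_word c))"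
proof -
  have "h \<in> cell_span"
    by (simp add: cell_span_UNIV)
  then show ?thesis
  proof (induction rule: hecke.span_induct_alt)
    case base
    then show ?case
      by simp
  next
    case (step k x y)
    then obtain c where x: "x = \<T> (cell_word c)"
      by auto
    have "(\<Sum>d\<in>UNIV. coords x d *\<^sub>H \<T> (cell_word d)) = (\<Sum>d\<in>UNIV. if c = d then x else 0)"
      by (intro sum.cong) (auto simp: x coords_cell_word unit_coord_def)
    then have "x = (\<Sum>d\<in>UNIV. coords x d *\<^sub>H \<T> (cell_word d))"
      by simp
    with step have "k *\<^sub>H x + y = k *\<^sub>H (\<Sum>d\<in>UNIV. coords x d *\<^sub>H \<T> (cell_word d))
        + (\<Sum>d\<in>UNIV. coords y d *\<^sub>H \<T> (cell_word d))"
      by simp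
    also have "\<dots> = (\<Sum>d\<in>UNIV. coords (k *\<^sub>H x + y) d *\<^sub>H \<T> (cell_word d))"
      by (simp add: hecke.scale_left_distrib sum.distrib hecke.scale_sum_right)
    finally show ?case .
  qed
qed

section \<open>The centralizer as a linear system and its basis\<close>

lemma coords_inject: "coords g = coords h \<longleftrightarrow> g = h"
  using hecke_eq_sum_coords[of g] hecke_eq_sum_coords[of h] by auto

lemma centralizer_s_iff: "h \<in> centralizer (\<T> [\<s>]) \<longleftrightarrow> s_ract (coords h) = s_act (coords h)"
  by (simp add: centralizer_def flip: coords_inject coords_mult_s_left coords_mult_s_right)

text \<open>The \<open>C1\<close> and \<open>Cu\<close> entries impose no condition. In each copy of
  the tensor square the entries with second index \<open>E0\<close> stay free, and six equations
  express the others through them.\<close>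

lemma s_ract_eq_s_act_iff:
  "s_ract f = s_act f \<longleftrightarrow>
    f (Ct E0 E1) = f (Ct E1 E0) \<and> f (Ct E0 E2) = f (Ct E2 E0) \<and>
    f (Ct E1 E2) = f (Ct E0 E0) + \<xi>\<^sub>1 * f (Ct E2 E0) \<and>
    f (Ct E2 E1) = f (Ct E0 E0) + \<xi>\<^sub>1 * f (Ct E2 E0) \<and>
    f (Ct E2 E2) = f (Ct E1 E0) + \<xi>\<^sub>2 * f (Ct E2 E0) \<and>
    f (Ct E1 E1) = f (Ct E2 E0) + \<xi>\<^sub>1 * f (Ct E1 E0) - \<xi>\<^sub>2 * f (Ct E0 E0) \<and>
    f (Ctt E0 E1) = f (Ctt E1 E0) \<and> f (Ctt E0 E2) = f (Ctt E2 E0) \<and>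
    f (Ctt E1 E2) = f (Ctt E0 E0) + \<xi>\<^sub>1 * f (Ctt E2 E0) \<and>
    f (Ctt E2 E1) = f (Ctt E0 E0) + \<xi>\<^sub>1 * f (Ctt E2 E0) \<and>
    f (Ctt E2 E2) = f (Ctt E1 E0) + \<xi>\<^sub>2 * f (Ctt E2 E0) \<and>
    f (Ctt E1 E1) = f (Ctt E2 E0) + \<xi>\<^sub>1 * f (Ctt E1 E0) - \<xi>\<^sub>2 * f (Ctt E0 E0)"
  (is "_ \<longleftrightarrow> ?R")
proof
  assume "s_ract f = s_act f"
  then have eq: "s_ract f c = s_act f c" for c
    by simp
  have 1: "f (Ct E0 E2) = f (Ct E2 E0)" "f (Ctt E0 E2) = f (Ctt E2 E0)"
    using eq[of "Ct E0 E0"] eq[of "Ctt E0 E0"] by simp_all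
  have 2: "f (Ct E2 E1) = f (Ct E0 E0) + \<xi>\<^sub>1 * f (Ct E2 E0)"
    "f (Ct E1 E2) = f (Ct E0 E0) + \<xi>\<^sub>1 * f (Ct E2 E0)"
    "f (Ctt E2 E1) = f (Ctt E0 E0) + \<xi>\<^sub>1 * f (Ctt E2 E0)"
    "f (Ctt E1 E2) = f (Ctt E0 E0) + \<xi>\<^sub>1 * f (Ctt E2 E0)"
    using eq[of "Ct E0 E1"] eq[of "Ct E1 E0"] eq[of "Ctt E0 E1"] eq[of "Ctt E1 E0"] 1 by simp_all
  have 3: "f (Ct E0 E1) = f (Ct E1 E0)" "f (Ctt E0 E1) = f (Ctt E1 E0)"
    using eq[of "Ct E1 E1"] eq[of "Ctt E1 E1"] 2 by simp_all
  have 4: "f (Ct E2 E2) = f (Ct E1 E0) + \<xi>\<^sub>2 * f (Ct E2 E0)"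
    "f (Ctt E2 E2) = f (Ctt E1 E0) + \<xi>\<^sub>2 * f (Ctt E2 E0)"
    using eq[of "Ct E2 E0"] eq[of "Ctt E2 E0"] by simp_all
  show ?R
    \<comment> \<open>The terms with \<open>\<xi>\<^sub>1 * \<xi>\<^sub>2\<close> coming from the
      entries (\<open>E2\<close>, \<open>E2\<close>) and (\<open>E2\<close>, \<open>E1\<close>)
      cancel.\<close>
    using eq[of "Ct E2 E1"] eq[of "Ctt E2 E1"] 1 2 3 4 by (simp add: algebra_simps)
next
  assume ?R
  then show "s_ract f = s_act f"
    by (simp add: fun_eq_iff cell_all expo_all algebra_simps)
qed

text \<open>The coordinates at the positions \<open>ps\<close> are functionals dual to
  \<open>bs\<close>, which gives independence. The condition on \<open>M\<close> is stated in
  coordinates so that it becomes a finite system of equations.\<close>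

lemma hecke_basisI:
  fixes bs :: "hecke list" and ps :: "cell list"
  assumes len: "length ps = length bs"
    and dual: "\<And>i j. i < length bs \<Longrightarrow> j < length bs \<Longrightarrow>
      coords (bs ! j) (ps ! i) = (if i = j then 1 else 0)"
    and M: "\<And>h. h \<in> M \<longleftrightarrow> coords h = coords (\<Sum>i<length bs. coords h (ps ! i) *\<^sub>H bs ! i)"
  shows "hecke_basis bs M"
proof -
  let ?n = "length bs"
  \<comment> \<open>\<open>F\<close> is the projection onto the span of \<open>bs\<close> along the
    common kernel of the coordinates at \<open>ps\<close>; \<open>M\<close> is its set of fixed
    points.\<close>
  define F where "F h = (\<Sum>i<?n. coords h (ps ! i) *\<^sub>H bs ! i)" for h
  have M_iff: "h \<in> M \<longleftrightarrow> F h = h" for h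
    using M[of h] by (auto simp: F_def coords_inject)
  have F_nth: "F (bs ! j) = bs ! j" if "j < ?n" for j
  proof -
    have "F (bs ! j) = (\<Sum>i<?n. if j = i then bs ! i else 0)"
      unfolding F_def by (intro sum.cong) (auto simp: dual that)
    then show ?thesis
      using that by simp
  qed
  have distinct: "distinct bs"
    unfolding distinct_conv_nth by (metis dual zero_neq_one)
  have coords_sum: "coords (sum g A) c = (\<Sum>x\<in>A. coords (g x) c)" for g :: "nat \<Rightarrow> hecke" and A c
    by (induction A rule: infinite_finite_induct) simp_all
  have "f x = 0" if sum0: "(\<Sum>x\<in>set bs. f x *\<^sub>H x) = 0" and "x \<in> set bs" for f x
  proof -
    from that obtain i where i: "i < ?n" "x = bs ! i"
      by (auto simp: in_set_conv_nth)
    have "(\<Sum>j<?n. f (bs ! j) *\<^sub>H bs ! j) = 0"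
      using sum0 sum.reindex_bij_betw[OF bij_betw_nth[OF distinct refl refl], of "\<lambda>x. f x *\<^sub>H x"]
      by simp
    then have "(\<Sum>j<?n. f (bs ! j) * coords (bs ! j) (ps ! i)) = 0"
      using coords_sum[of "\<lambda>j. f (bs ! j) *\<^sub>H bs ! j" "{..<?n}" "ps ! i"] by simp
    also have "(\<Sum>j<?n. f (bs ! j) * coords (bs ! j) (ps ! i)) = (\<Sum>j<?n. if i = j then f (bs ! j) else 0)"
      by (intro sum.cong) (auto simp: dual i)
    finally show "f x = 0"
      using i by simp
  qed
  then have "hecke.independent (set bs)"
    by (auto simp: hecke.dependent_finite)
  moreover have "hecke.span (set bs) = M"
  proof
    have "F h = h" if "h \<in> hecke.span (set bs)" for h
      using that
    proof (induction rule: hecke.span_induct_alt)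
      case base
      then show ?case
        by (simp add: F_def)
    next
      case (step c x y)
      then have "F x = x"
        using F_nth by (metis in_set_conv_nth)
      moreover have "F (c *\<^sub>H x + y) = c *\<^sub>H F x + F y"
        by (simp add: F_def hecke.scale_left_distrib sum.distrib hecke.scale_sum_right)
      ultimately show ?case
        using step by simp
    qed
    then show "hecke.span (set bs) \<subseteq> M"
      by (auto simp: M_iff)
    have "F h \<in> hecke.span (set bs)" for h
      unfolding F_def by (intro hecke.span_sum hecke.span_scale hecke.span_base) simp
    then show "M \<subseteq> hecke.span (set bs)"
      by (metis M_iff subsetI)
  qed
  ultimately show ?thesis
    using distinct by (simp add: hecke_basis_def)
qed

theorem proposition3p4:
  shows "hecke_basis
    [\<T> [],
     \<T> [\<s>],
     \<T> [\<s>, \<s>],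
     \<T> [\<t>, \<s>, \<s>, \<t>],
     \<T> [\<t>, \<s>, \<s>, \<t>, \<s>],
     \<T> [\<t>, \<s>, \<t>, \<s>, \<t>, \<s>],
     \<T> [\<t>] + \<T> [\<s>, \<s>, \<t>, \<s>] + \<T> [\<s>, \<t>, \<s>, \<s>] - \<xi>\<^sub>2 *\<^sub>H \<T> [\<s>, \<t>, \<s>],
     \<T> [\<t>, \<t>] + \<T> [\<s>, \<s>, \<t>, \<t>, \<s>] + \<T> [\<s>, \<t>, \<t>, \<s>, \<s>] - \<xi>\<^sub>2 *\<^sub>H \<T> [\<s>, \<t>, \<t>, \<s>],
     \<T> [\<s>, \<t>] + \<T> [\<t>, \<s>] + \<T> [\<s>, \<s>, \<t>, \<s>, \<s>] + \<xi>\<^sub>1 *\<^sub>H \<T> [\<s>, \<t>, \<s>],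
     \<T> [\<s>, \<t>, \<t>] + \<T> [\<t>, \<t>, \<s>] + \<T> [\<s>, \<s>, \<t>, \<t>, \<s>, \<s>] + \<xi>\<^sub>1 *\<^sub>H \<T> [\<s>, \<t>, \<t>, \<s>],
     \<T> [\<s>, \<s>, \<t>] + \<T> [\<t>, \<s>, \<s>] + \<T> [\<s>, \<t>, \<s>] + \<xi>\<^sub>1 *\<^sub>H \<T> [\<s>, \<s>, \<t>, \<s>]
       + \<xi>\<^sub>1 *\<^sub>H \<T> [\<s>, \<t>, \<s>, \<s>] + \<xi>\<^sub>2 *\<^sub>H \<T> [\<s>, \<s>, \<t>, \<s>, \<s>],
     \<T> [\<s>, \<s>, \<t>, \<t>] + \<T> [\<t>, \<t>, \<s>, \<s>] + \<T> [\<s>, \<t>, \<t>, \<s>] + \<xi>\<^sub>1 *\<^sub>H \<T> [\<s>, \<s>, \<t>, \<t>, \<s>]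
       + \<xi>\<^sub>1 *\<^sub>H \<T> [\<s>, \<t>, \<t>, \<s>, \<s>] + \<xi>\<^sub>2 *\<^sub>H \<T> [\<s>, \<s>, \<t>, \<t>, \<s>, \<s>]]
    (centralizer (\<T> [\<s>]))"
\<comment> \<open>The positions are the coefficients left free by
  \<open>s_ract_eq_s_act_iff\<close>, in the order of the list. Each element arises by setting one
  of them to 1 and the others to 0.\<close>
proof (rule hecke_basisI[where ps = "[C1 E0, C1 E1, C1 E2, Cu E0, Cu E1, Cu E2,
    Ct E0 E0, Ctt E0 E0, Ct E1 E0, Ctt E1 E0, Ct E2 E0, Ctt E2 E0]"], goal_cases)
  case 1
  show ?case
    by simp
next
  case (2 i j)
  then show ?case
    by (auto simp: less_Suc_eq unit_coord_def)
next
  case (3 h)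
  show ?case
    \<comment> \<open>At the twelve free positions the expansion holds trivially; at the other
      twelve it is the system of \<open>s_ract_eq_s_act_iff\<close>.\<close>
    unfolding centralizer_s_iff s_ract_eq_s_act_iff
    by (simp add: lessThan_Suc fun_eq_iff cell_all expo_all unit_coord_def) (auto simp: algebra_simps)
qed

end
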